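(* Let $\mathbb{X}$ be a traced extensive restriction category with parametrized iteration operator $\mathsf{Iter}$ and induced trace operator $\mathsf{Tr}$. For $\perp_d$-disjoint maps $f:X\to X$ and $g:X\to A$ define $$ f\circledast g:=\mathsf{Iter}^X_A\big(\begin{bmatrix} f&g\end{bmatrix}\big)=\mathsf{Tr}^X_{X,A}\big(\nabla_X\begin{bmatrix} f&g\end{bmatrix}\big). $$ Then $\circledast$ is a Kleene wand for $\perp_d$, so $(\mathbb{X},\circledast)$ is a $\perp_d$-itegory. Moreover, if $\mathsf{Iter}$ is uniform, then $\circledast$ is uniform.
   Context: Composition is diagrammatic: $fg$ means first $f$, then $g$. A restriction category is a category with an operator sending each $f:A\to B$ to $\overline{f}:A\to A$ such that $\overline{f}f=f$; $\overline{f}\,\overline{g}=\overline{g}\,\overline{f}$ and $\overline{\overline{g}f}=\overline{g}\,\overline{f}$ for $f:A\to B$, $g:A\to C$; and $f\overline{g}=\overline{fg}f$ for $f:A\to B$, $g:B\to C$. For parallel $f,g$: $f\le g$ iff $\overline{f}g=f$. A map $f:A\to B$ is total if $\overline{f}=1_A$. Restriction zeroes: maps $0:A\to B$ with $f0=0=0f$ and $\overline{0}=0$. A coCartesian restriction category is a restriction category with finite coproducts whose injections $\iota_j$ are total. With restriction zeroes, the quasi-projection $\iota_j^\circ:A_1+\dots+A_n\to A_j$ is the unique map with $\iota_j\iota_j^\circ=1_{A_j}$ and $\iota_i\iota_j^\circ=0$ for $i\ne j$. $\nabla:A+\dots+A\to A$ is the codiagonal; copairing is written as a column. An extensive restriction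 category is a coCartesian restriction category with restriction zeroes such that for every $f:A\to B_1+\dots+B_n$ there is a (necessarily unique) map $\langle f\rangle:A\to A+\dots+A$ ($n$ copies) with $\overline{f}=\langle f\rangle\nabla$ and $\langle f\rangle(f+\dots+f)=f(\iota_1+\dots+\iota_n)$. A map $d:A\to A+\dots+A$ is a decision if $\langle d\rangle=d$. For $f:A\to B$, $g:A\to C$, $f\perp_d g$ iff there is a (necessarily unique) decision $\langle f\vert g\rangle:A\to A+A$ with $\langle f\vert g\rangle\iota_1^\circ=\overline{f}$, $\langle f\vert g\rangle\iota_2^\circ=\overline{g}$. This is an interference relation with all binary joins: for parallel $f\perp_d g:A\to B$, $f\sqcup g:=\langle f\vert g\rangle(f+g)\nabla$ is their least upper bound for $\le$, and it is preserved by precomposition. For $f\perp_d g$, $\begin{bmatrix} f&g\end{bmatrix}:=\langle f\vert g\rangle(f+g):A\to B+C$; every map $h:A\to B+C$ is uniquely of this form, with $f=h\iota_1^\circ$, $g=h\iota_2^\circ$. A Kleene wand $\circledast$ with respect to $\perp=\perp_d$ assigns to each $f:X\to X$, $g:X\to A$ with $f\perp g$ a map $f\circledast g:X\to A$ such that: (1) if $f \perp g$, then $g\sqcup f(f\circledast g)=f\circledast g$; (2) $(f\circledast g)h=f\circledast gh$ for $f\perp g$, $h:A\to B$; (3) for $f:X\to Y$, $g:X\to A$, $k:Y\to X$ with $f\perp g$: $kf\circledast kg=k(fk\circledast g)$; (4) for $f,f':X\to X$, $g:X\to A$ with $f\perp f'$ and $f\sqcup f'\perp g$: $(f\circledast f')\perp(f\circledast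 g)$ and $(f\sqcup f')\circledast g=(f\circledast f')\circledast(f\circledast g)$. A $\perp_d$-itegory here means the category with such a wand. The wand is uniform if for $f:X\to X$, $g:X\to A$, $f':Y\to Y$, $g':Y\to A$, $h:X\to Y$ with $f\perp g$, $f'\perp g'$, $hg'=g$, $hf'=fh$ one has $h(f'\circledast g')=f\circledast g$. A parametrized iteration operator on a category with finite coproducts is a family of operators $\mathsf{Iter}^X_A$ sending $f:X\to X+A$ to $\mathsf{Iter}^X_A(f):X\to A$ such that: [Parametrized Iteration] $f\left[\begin{smallmatrix}\mathsf{Iter}^X_A(f)\\ 1_A\end{smallmatrix}\right]=\mathsf{Iter}^X_A(f)$; [Naturality] $\mathsf{Iter}^X_A(f(1_X+h))=\mathsf{Iter}^X_{A'}(f)h$ for $f:X\to X+A'$, $h:A'\to A$; [Dinaturality] $\mathsf{Iter}^X_A(kf)=k\,\mathsf{Iter}^{X'}_A(f(k+1_A))$ for $f:X'\to X+A$, $k:X\to X'$; [Diagonal] $\mathsf{Iter}^X_A(\mathsf{Iter}^X_{X+A}(f))=\mathsf{Iter}^X_A(f(\nabla_X+1_A))$ for $f:X\to X+X+A$. It is uniform if $f(h+1_A)=hf'$ (with $f:X\to X+A$, $f':Y\to Y+A$, $h:X\to Y$) implies $\mathsf{Iter}^X_A(f)=h\,\mathsf{Iter}^Y_A(f')$. The induced trace operator is $\mathsf{Tr}^X_{A,B}(f)=\iota_2f\left[\begin{smallmatrix}\mathsf{Iter}^X_B(\iota_1f)\\1_B\end{smallmatrix}\right]$ for $f:X+A\to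 X+B$. A traced extensive restriction category is an extensive restriction category equipped with a parametrized iteration operator (equivalently, with a trace operator for the coproduct). *)

theory Defs
  imports Main
begin

text \<open>
  Composition is diagrammatic: \<open>f \<cdot> g\<close> is first \<open>f\<close>, then \<open>g\<close>. Finite coproducts are chosen,
  one for every list of objects, and are indexed from 0, so \<open>\<iota>\<^sub>1\<close> on \<open>A + B\<close> is
  \<open>inj\<^sub>c [A, B] 0\<close>. The coproduct operation need not be injective on objects, so operations on
  maps into or out of a coproduct take the summands as arguments.
\<close>

section \<open>Restriction categories\<close>

record ('o, 'm) cat =
  Ob :: "'o set"
  Mor :: "'m set"
  Dom :: "'m \<Rightarrow> 'o"
  Cod :: "'m \<Rightarrow> 'o"
  Comp :: "'m \<Rightarrow> 'm \<Rightarrow> 'm" (infixl "\<cdot>\<index>" 70)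
  Idn :: "'o \<Rightarrow> 'm" ("\<one>\<index>")

definition hom :: "('o, 'm, 'x) cat_scheme \<Rightarrow> 'o \<Rightarrow> 'o \<Rightarrow> 'm set" where
  "hom C A B = {f \<in> Mor C. Dom C f = A \<and> Cod C f = B}"

locale category =
  fixes C (structure)
  assumes dom_Ob: "f \<in> Mor C \<Longrightarrow> Dom C f \<in> Ob C"
    and cod_Ob: "f \<in> Mor C \<Longrightarrow> Cod C f \<in> Ob C"
    and id_hom: "A \<in> Ob C \<Longrightarrow> \<one> A \<in> hom C A A"
    and comp_hom: "\<lbrakk>f \<in> hom C A B; g \<in> hom C B D\<rbrakk> \<Longrightarrow> f \<cdot> g \<in> hom C A D"
    and id_left: "f \<in> hom C A B \<Longrightarrow> \<one> A \<cdot> f = f"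
    and id_right: "f \<in> hom C A B \<Longrightarrow> f \<cdot> \<one> B = f"
    and comp_assoc:
      "\<lbrakk>f \<in> hom C A B; g \<in> hom C B D; h \<in> hom C D E\<rbrakk> \<Longrightarrow> (f \<cdot> g) \<cdot> h = f \<cdot> (g \<cdot> h)"

record ('o, 'm) rcat = "('o, 'm) cat" +
  Rst :: "'m \<Rightarrow> 'm" ("\<rho>\<index>")

locale restriction_category = category C for C (structure) +
  assumes rst_hom: "f \<in> hom C A B \<Longrightarrow> \<rho> f \<in> hom C A A"
    and rst_comp: "f \<in> hom C A B \<Longrightarrow> \<rho> f \<cdot> f = f"
    and rst_commute: "\<lbrakk>f \<in> hom C A B; g \<in> hom C A D\<rbrakk> \<Longrightarrow> \<rho> f \<cdot> \<rho> g = \<rho> g \<cdot> \<rho> f"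
    and rst_rst_comp: "\<lbrakk>f \<in> hom C A B; g \<in> hom C A D\<rbrakk> \<Longrightarrow> \<rho> (\<rho> g \<cdot> f) = \<rho> g \<cdot> \<rho> f"
    and comp_rst: "\<lbrakk>f \<in> hom C A B; g \<in> hom C B D\<rbrakk> \<Longrightarrow> f \<cdot> \<rho> g = \<rho> (f \<cdot> g) \<cdot> f"

definition total_map :: "('o, 'm, 'x) rcat_scheme \<Rightarrow> 'm \<Rightarrow> bool" where
  "total_map C f \<longleftrightarrow> f \<in> Mor C \<and> \<rho> f = \<one> (Dom C f)"
  for C (structure)

section \<open>Finite coproducts and restriction zeroes\<close>

record ('o, 'm) ecat = "('o, 'm) rcat" +
  Coprod :: "'o list \<Rightarrow> 'o" ("\<Oplus>\<index>")
  Inj :: "'o list \<Rightarrow> nat \<Rightarrow> 'm" ("inj\<^sub>c\<index>")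
  Zero :: "'o \<Rightarrow> 'o \<Rightarrow> 'm" ("\<zero>\<index>")

locale cocartesian_restriction_category = restriction_category C for C (structure) +
  assumes coprod_Ob: "set As \<subseteq> Ob C \<Longrightarrow> \<Oplus> As \<in> Ob C"
    and inj_hom: "\<lbrakk>set As \<subseteq> Ob C; i < length As\<rbrakk> \<Longrightarrow> inj\<^sub>c As i \<in> hom C (As ! i) (\<Oplus> As)"
    and inj_total: "\<lbrakk>set As \<subseteq> Ob C; i < length As\<rbrakk> \<Longrightarrow> total_map C (inj\<^sub>c As i)"
    and coprod_universal:
      "\<lbrakk>set As \<subseteq> Ob C; B \<in> Ob C; length fs = length As;
        \<And>i. i < length As \<Longrightarrow> fs ! i \<in> hom C (As ! i) B\<rbrakk>
       \<Longrightarrow> \<exists>!h. h \<in> hom C (\<Oplus> As) B \<and> (\<forall>i < length As. inj\<^sub>c As i \<cdot> h = fs ! i)"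

locale restriction_zeroes =
  fixes C (structure)
  assumes zero_hom: "\<lbrakk>A \<in> Ob C; B \<in> Ob C\<rbrakk> \<Longrightarrow> \<zero> A B \<in> hom C A B"
    and comp_zero: "\<lbrakk>f \<in> hom C A B; D \<in> Ob C\<rbrakk> \<Longrightarrow> f \<cdot> \<zero> B D = \<zero> A D"
    and zero_comp: "\<lbrakk>A \<in> Ob C; f \<in> hom C B D\<rbrakk> \<Longrightarrow> \<zero> A B \<cdot> f = \<zero> A D"
    and rst_zero: "\<lbrakk>A \<in> Ob C; B \<in> Ob C\<rbrakk> \<Longrightarrow> \<rho> (\<zero> A B) = \<zero> A A"

text \<open>The copairing (column) of the maps \<open>fs\<close> with common codomain \<open>B\<close>.\<close>

definition cotuple :: "('o, 'm, 'x) ecat_scheme \<Rightarrow> 'o \<Rightarrow> 'm list \<Rightarrow> 'm" where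
  "cotuple C B fs =
    (THE h. h \<in> hom C (\<Oplus> (map (Dom C) fs)) B \<and>
            (\<forall>i < length fs. inj\<^sub>c (map (Dom C) fs) i \<cdot> h = fs ! i))"
  for C (structure)

definition map_sum :: "('o, 'm, 'x) ecat_scheme \<Rightarrow> 'm list \<Rightarrow> 'm" where
  "map_sum C fs =
    cotuple C (\<Oplus> (map (Cod C) fs))
      (map (\<lambda>i. fs ! i \<cdot> inj\<^sub>c (map (Cod C) fs) i) [0..<length fs])"
  for C (structure)

definition codiag :: "('o, 'm, 'x) ecat_scheme \<Rightarrow> nat \<Rightarrow> 'o \<Rightarrow> 'm" where
  "codiag C n A = cotuple C A (replicate n (\<one> A))"
  for C (structure)

definition quasi_proj :: "('o, 'm, 'x) ecat_scheme \<Rightarrow> 'o list \<Rightarrow> nat \<Rightarrow> 'm" where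
  "quasi_proj C As j =
    (THE q. q \<in> hom C (\<Oplus> As) (As ! j) \<and> inj\<^sub>c As j \<cdot> q = \<one> (As ! j) \<and>
            (\<forall>i < length As. i \<noteq> j \<longrightarrow> inj\<^sub>c As i \<cdot> q = \<zero> (As ! i) (As ! j)))"
  for C (structure)

section \<open>Extensive restriction categories\<close>

text \<open>\<open>e\<close> satisfies the two equations characterizing \<open>\<langle>f\<rangle>\<close>, for \<open>f : A \<rightarrow> B\<^sub>1 + \<dots> + B\<^sub>n\<close>.\<close>

definition decides :: "('o, 'm, 'x) ecat_scheme \<Rightarrow> 'o list \<Rightarrow> 'm \<Rightarrow> 'm \<Rightarrow> bool" where
  "decides C Bs f e \<longleftrightarrow>
    e \<in> hom C (Dom C f) (\<Oplus> (replicate (length Bs) (Dom C f))) \<and>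
    \<rho> f = e \<cdot> codiag C (length Bs) (Dom C f) \<and>
    e \<cdot> map_sum C (replicate (length Bs) f) = f \<cdot> map_sum C (map (inj\<^sub>c Bs) [0..<length Bs])"
  for C (structure)

locale extensive_restriction_category =
  cocartesian_restriction_category C + restriction_zeroes C for C (structure) +
  assumes decision_exists:
    "\<lbrakk>set Bs \<subseteq> Ob C; f \<in> hom C A (\<Oplus> Bs)\<rbrakk> \<Longrightarrow> \<exists>e. decides C Bs f e"

definition decision_of :: "('o, 'm, 'x) ecat_scheme \<Rightarrow> 'o list \<Rightarrow> 'm \<Rightarrow> 'm" where
  "decision_of C Bs f = (THE e. decides C Bs f e)"

definition is_decision :: "('o, 'm, 'x) ecat_scheme \<Rightarrow> nat \<Rightarrow> 'o \<Rightarrow> 'm \<Rightarrow> bool" where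
  "is_decision C n A d \<longleftrightarrow>
    d \<in> hom C A (\<Oplus> (replicate n A)) \<and> decision_of C (replicate n A) d = d"
  for C (structure)

definition separates :: "('o, 'm, 'x) ecat_scheme \<Rightarrow> 'm \<Rightarrow> 'm \<Rightarrow> 'm \<Rightarrow> bool" where
  "separates C f g d \<longleftrightarrow>
    is_decision C 2 (Dom C f) d \<and>
    d \<cdot> quasi_proj C [Dom C f, Dom C f] 0 = \<rho> f \<and>
    d \<cdot> quasi_proj C [Dom C f, Dom C f] 1 = \<rho> g"
  for C (structure)

definition dperp :: "('o, 'm, 'x) ecat_scheme \<Rightarrow> 'm \<Rightarrow> 'm \<Rightarrow> bool" (infix "\<bottom>\<index>" 50) where
  "f \<bottom> g \<longleftrightarrow> f \<in> Mor C \<and> g \<in> Mor C \<and> Dom C f = Dom C g \<and> (\<exists>d. separates C f g d)"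
  for C (structure)

text \<open>\<open>\<langle>f | g\<rangle>\<close>, the row matrix \<open>[f g]\<close> and the join \<open>f \<squnion> g\<close>; only meaningful when \<open>f \<bottom> g\<close>.\<close>

definition separator :: "('o, 'm, 'x) ecat_scheme \<Rightarrow> 'm \<Rightarrow> 'm \<Rightarrow> 'm" where
  "separator C f g = (THE d. separates C f g d)"

definition row :: "('o, 'm, 'x) ecat_scheme \<Rightarrow> 'm \<Rightarrow> 'm \<Rightarrow> 'm" where
  "row C f g = separator C f g \<cdot> map_sum C [f, g]"
  for C (structure)

definition join :: "('o, 'm, 'x) ecat_scheme \<Rightarrow> 'm \<Rightarrow> 'm \<Rightarrow> 'm" (infixl "\<squnion>\<index>" 65) where
  "f \<squnion> g = separator C f g \<cdot> map_sum C [f, g] \<cdot> codiag C 2 (Cod C f)"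
  for C (structure)

section \<open>Kleene wands\<close>

text \<open>
  A wand is only meaningful on disjoint pairs, so its values on other pairs are left unconstrained.
  Each axiom asserts, besides the equation, that every wand and join occurring in it is applied
  to a disjoint pair.
\<close>

locale kleene_wand =
  fixes C (structure) and W :: "'m \<Rightarrow> 'm \<Rightarrow> 'm" (infix "\<circledast>" 68)
  assumes wand_hom: "\<lbrakk>f \<in> hom C X X; g \<in> hom C X A; f \<bottom> g\<rbrakk> \<Longrightarrow> f \<circledast> g \<in> hom C X A"
    and wand_unfold:
      "\<lbrakk>f \<in> hom C X X; g \<in> hom C X A; f \<bottom> g\<rbrakk>
       \<Longrightarrow> g \<bottom> (f \<cdot> (f \<circledast> g)) \<and> g \<squnion> (f \<cdot> (f \<circledast> g)) = f \<circledast> g"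
    and wand_natural:
      "\<lbrakk>f \<in> hom C X X; g \<in> hom C X A; h \<in> hom C A B; f \<bottom> g\<rbrakk>
       \<Longrightarrow> f \<bottom> (g \<cdot> h) \<and> (f \<circledast> g) \<cdot> h = f \<circledast> (g \<cdot> h)"
    and wand_dinatural:
      "\<lbrakk>f \<in> hom C X Y; g \<in> hom C X A; k \<in> hom C Y X; f \<bottom> g\<rbrakk>
       \<Longrightarrow> (k \<cdot> f) \<bottom> (k \<cdot> g) \<and> (f \<cdot> k) \<bottom> g \<and>
           (k \<cdot> f) \<circledast> (k \<cdot> g) = k \<cdot> ((f \<cdot> k) \<circledast> g)"
    and wand_diagonal:
      "\<lbrakk>f \<in> hom C X X; f' \<in> hom C X X; g \<in> hom C X A; f \<bottom> f'; (f \<squnion> f') \<bottom> g\<rbrakk>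
       \<Longrightarrow> f \<bottom> g \<and> (f \<circledast> f') \<bottom> (f \<circledast> g) \<and>
           (f \<squnion> f') \<circledast> g = (f \<circledast> f') \<circledast> (f \<circledast> g)"

locale perp_itegory = extensive_restriction_category C + kleene_wand C W
  for C (structure) and W

definition uniform_wand :: "('o, 'm, 'x) ecat_scheme \<Rightarrow> ('m \<Rightarrow> 'm \<Rightarrow> 'm) \<Rightarrow> bool" where
  "uniform_wand C W \<longleftrightarrow>
    (\<forall>X Y A f g f' g' h.
       f \<in> hom C X X \<and> g \<in> hom C X A \<and> f' \<in> hom C Y Y \<and> g' \<in> hom C Y A \<and> h \<in> hom C X Y \<and>
       f \<bottom> g \<and> f' \<bottom> g' \<and> h \<cdot> g' = g \<and> h \<cdot> f' = f \<cdot> h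
       \<longrightarrow> h \<cdot> W f' g' = W f g)"
  for C (structure)

section \<open>Parametrized iteration\<close>

text \<open>The associator \<open>A + (B + D) \<rightarrow> (A + B) + D\<close>.\<close>

definition assoc_map :: "('o, 'm, 'x) ecat_scheme \<Rightarrow> 'o \<Rightarrow> 'o \<Rightarrow> 'o \<Rightarrow> 'm" where
  "assoc_map C A B D =
    (let T = \<Oplus> [\<Oplus> [A, B], D]; l = inj\<^sub>c [\<Oplus> [A, B], D] 0; r = inj\<^sub>c [\<Oplus> [A, B], D] 1
     in cotuple C T [inj\<^sub>c [A, B] 0 \<cdot> l, cotuple C T [inj\<^sub>c [A, B] 1 \<cdot> l, r]])"
  for C (structure)

text \<open>\<open>Iter X A f : X \<rightarrow> A\<close> for \<open>f : X \<rightarrow> X + A\<close>. In the diagonal axiom \<open>X + X + A\<close> is read as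
  \<open>X + (X + A)\<close> and the associator is made explicit.\<close>

locale parametrized_iteration =
  fixes C (structure) and Iter :: "'o \<Rightarrow> 'o \<Rightarrow> 'm \<Rightarrow> 'm"
  assumes iter_hom:
      "\<lbrakk>A \<in> Ob C; f \<in> hom C X (\<Oplus> [X, A])\<rbrakk> \<Longrightarrow> Iter X A f \<in> hom C X A"
    and iter_unfold:
      "\<lbrakk>A \<in> Ob C; f \<in> hom C X (\<Oplus> [X, A])\<rbrakk>
       \<Longrightarrow> f \<cdot> cotuple C A [Iter X A f, \<one> A] = Iter X A f"
    and iter_natural:
      "\<lbrakk>f \<in> hom C X (\<Oplus> [X, A']); h \<in> hom C A' A\<rbrakk>
       \<Longrightarrow> Iter X A (f \<cdot> map_sum C [\<one> X, h]) = Iter X A' f \<cdot> h"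
    and iter_dinatural:
      "\<lbrakk>A \<in> Ob C; f \<in> hom C X' (\<Oplus> [X, A]); k \<in> hom C X X'\<rbrakk>
       \<Longrightarrow> Iter X A (k \<cdot> f) = k \<cdot> Iter X' A (f \<cdot> map_sum C [k, \<one> A])"
    and iter_diagonal:
      "\<lbrakk>A \<in> Ob C; f \<in> hom C X (\<Oplus> [X, \<Oplus> [X, A]])\<rbrakk>
       \<Longrightarrow> Iter X A (Iter X (\<Oplus> [X, A]) f) =
           Iter X A (f \<cdot> (assoc_map C X X A \<cdot> map_sum C [codiag C 2 X, \<one> A]))"

definition uniform_iteration ::
  "('o, 'm, 'x) ecat_scheme \<Rightarrow> ('o \<Rightarrow> 'o \<Rightarrow> 'm \<Rightarrow> 'm) \<Rightarrow> bool" where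
  "uniform_iteration C Iter \<longleftrightarrow>
    (\<forall>X Y A f f' h.
       A \<in> Ob C \<and> f \<in> hom C X (\<Oplus> [X, A]) \<and> f' \<in> hom C Y (\<Oplus> [Y, A]) \<and> h \<in> hom C X Y \<and>
       f \<cdot> map_sum C [h, \<one> A] = h \<cdot> f'
       \<longrightarrow> Iter X A f = h \<cdot> Iter Y A f')"
  for C (structure)

locale traced_extensive_restriction_category =
  extensive_restriction_category C + parametrized_iteration C Iter
  for C (structure) and Iter

text \<open>\<open>Tr\<^sup>X\<^bsub>A,B\<^esub>(f) : A \<rightarrow> B\<close> for \<open>f : X + A \<rightarrow> X + B\<close>.\<close>

definition induced_trace ::
  "('o, 'm, 'x) ecat_scheme \<Rightarrow> ('o \<Rightarrow> 'o \<Rightarrow> 'm \<Rightarrow> 'm) \<Rightarrow> 'o \<Rightarrow> 'o \<Rightarrow> 'o \<Rightarrow> 'm \<Rightarrow> 'm" where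
  "induced_trace C Iter X A B f =
    inj\<^sub>c [X, A] 1 \<cdot> f \<cdot> cotuple C B [Iter X B (inj\<^sub>c [X, A] 0 \<cdot> f), \<one> B]"
  for C (structure)

definition iter_wand ::
  "('o, 'm, 'x) ecat_scheme \<Rightarrow> ('o \<Rightarrow> 'o \<Rightarrow> 'm \<Rightarrow> 'm) \<Rightarrow> 'm \<Rightarrow> 'm \<Rightarrow> 'm" where
  "iter_wand C Iter f g = Iter (Dom C f) (Cod C g) (row C f g)"

end

theory Submission
  imports Defs
begin

text \<open>
  If \<open>e\<close> decides \<open>f : A \<rightarrow> B\<^sub>1 + \<dots> + B\<^sub>n\<close> and \<open>f\<^sub>i = f \<iota>\<^sub>i\<degree>\<close>, then \<open>e \<iota>\<^sub>i\<degree> = \<rho> f\<^sub>i\<close>,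
  \<open>f = e (f\<^sub>1 + \<dots> + f\<^sub>n)\<close> and \<open>e = e (\<rho> f\<^sub>1 + \<dots> + \<rho> f\<^sub>n)\<close>. If \<open>g\<close> has the same components \<open>f\<^sub>i\<close>, then
  \<open>f\<^sub>1 + \<dots> + f\<^sub>n = (\<rho> f\<^sub>1 + \<dots> + \<rho> f\<^sub>n) \<nabla> g\<close>, so \<open>f = e \<nabla> g = \<rho> f g\<close>, and \<open>f = g\<close> by symmetry. Thus a
  map into a coproduct is determined by its components, and \<open>f \<bottom> g\<close> holds iff some \<open>h\<close> has
  components \<open>f\<close> and \<open>g\<close>, in which case \<open>h = [f g]\<close>. Matrix algebra now turns each iteration
  axiom into the wand axiom of the same name. For the diagonal axiom, \<open>[f [f' g]]\<close> is \<open>[[f f'] g]\<close>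
  up to reassociation, and by naturality along the two quasi-projections its iterate has columns
  \<open>f \<circledast> f'\<close> and \<open>f \<circledast> g\<close>.
\<close>

section \<open>Restriction categories\<close>

definition homs :: "('o, 'm, 'x) cat_scheme \<Rightarrow> 'o list \<Rightarrow> 'o list \<Rightarrow> 'm list set" where
  "homs C As Bs = {fs. length fs = length As \<and> length Bs = length As \<and>
    (\<forall>i < length As. fs ! i \<in> hom C (As ! i) (Bs ! i))}"

lemma homs_Nil [simp]: "[] \<in> homs C [] []"
  by (simp add: homs_def)

lemma homs_Cons [simp]:
  "f # fs \<in> homs C (A # As) (B # Bs) \<longleftrightarrow> f \<in> hom C A B \<and> fs \<in> homs C As Bs"
  by (auto simp: homs_def All_less_Suc2)

lemma homs_map_Dom: "fs \<in> homs C As Bs \<Longrightarrow> map (Dom C) fs = As"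
  by (auto simp: homs_def hom_def intro: nth_equalityI)

lemma homs_map_Cod: "fs \<in> homs C As Bs \<Longrightarrow> map (Cod C) fs = Bs"
  by (auto simp: homs_def hom_def intro: nth_equalityI)

context category
begin

declare dom_Ob [simp] cod_Ob [simp]

lemma in_hom_iff [simp]:
  "f \<in> hom C A B \<longleftrightarrow> f \<in> Mor C \<and> Dom C f = A \<and> Cod C f = B \<and> A \<in> Ob C \<and> B \<in> Ob C"
  by (auto simp: hom_def)

lemma comp_arr [simp]:
  assumes "f \<in> Mor C" "g \<in> Mor C" "Cod C f = Dom C g"
  shows "f \<cdot> g \<in> Mor C" "Dom C (f \<cdot> g) = Dom C f" "Cod C (f \<cdot> g) = Cod C g"
  using comp_hom[of f "Dom C f" "Dom C g" g "Cod C g"] assms by simp_all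

lemma comp_assoc_arr [simp]:
  assumes "f \<in> Mor C" "g \<in> Mor C" "h \<in> Mor C" "Cod C f = Dom C g" "Cod C g = Dom C h"
  shows "f \<cdot> g \<cdot> h = f \<cdot> (g \<cdot> h)"
  using comp_assoc[of f "Dom C f" "Dom C g" g "Dom C h" h "Cod C h"] assms by simp

lemma comp_reassoc:
  assumes "f \<cdot> g = k" "f \<in> Mor C" "g \<in> Mor C" "h \<in> Mor C" "Cod C f = Dom C g" "Cod C g = Dom C h"
  shows "f \<cdot> (g \<cdot> h) = k \<cdot> h"
  using assms comp_assoc_arr by metis

lemma id_arr [simp]:
  assumes "A \<in> Ob C"
  shows "\<one> A \<in> Mor C" "Dom C (\<one> A) = A" "Cod C (\<one> A) = A"
  using id_hom[OF assms] by simp_all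

lemma id_comp [simp]: "f \<in> Mor C \<Longrightarrow> Dom C f = A \<Longrightarrow> \<one> A \<cdot> f = f"
  by (rule id_left) auto

lemma comp_id [simp]: "f \<in> Mor C \<Longrightarrow> Cod C f = B \<Longrightarrow> f \<cdot> \<one> B = f"
  by (rule id_right) auto

lemma nth_in_Ob [simp]: "set As \<subseteq> Ob C \<Longrightarrow> i < length As \<Longrightarrow> As ! i \<in> Ob C"
  using nth_mem by blast

lemma replicate_in_Ob [simp]: "A \<in> Ob C \<Longrightarrow> set (replicate n A) \<subseteq> Ob C"
  by auto

lemma homs_nth:
  assumes "fs \<in> homs C As Bs" "i < length As"
  shows "fs ! i \<in> Mor C" "Dom C (fs ! i) = As ! i" "Cod C (fs ! i) = Bs ! i"
  using assms by (simp_all add: homs_def)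

lemma homs_Ob: "fs \<in> homs C As Bs \<Longrightarrow> set As \<subseteq> Ob C \<and> set Bs \<subseteq> Ob C"
  by (force simp: homs_def in_set_conv_nth)

end

context restriction_category
begin

lemma rst_arr [simp]:
  assumes "f \<in> Mor C"
  shows "\<rho> f \<in> Mor C" "Dom C (\<rho> f) = Dom C f" "Cod C (\<rho> f) = Dom C f"
  using rst_hom[of f "Dom C f" "Cod C f"] assms by simp_all

lemma rst_comp_self [simp]: "f \<in> Mor C \<Longrightarrow> \<rho> f \<cdot> f = f"
  by (rule rst_comp) auto

lemma comp_rst_arr:
  "f \<in> Mor C \<Longrightarrow> g \<in> Mor C \<Longrightarrow> Cod C f = Dom C g \<Longrightarrow> f \<cdot> \<rho> g = \<rho> (f \<cdot> g) \<cdot> f"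
  by (rule comp_rst) auto

lemma rst_id [simp]: "A \<in> Ob C \<Longrightarrow> \<rho> (\<one> A) = \<one> A"
  using rst_comp_self[of "\<one> A"] by simp

lemma rst_rst [simp]: "f \<in> Mor C \<Longrightarrow> \<rho> (\<rho> f) = \<rho> f"
  using rst_rst_comp[of "\<one> (Dom C f)" "Dom C f" "Dom C f" f "Cod C f"] by simp

lemma rst_comp_total:
  assumes f: "f \<in> hom C A B" and g: "g \<in> hom C B D" and total: "\<rho> g = \<one> B"
  shows "\<rho> (f \<cdot> g) = \<rho> f"
proof -
  have fg: "f \<cdot> g \<in> hom C A D" using f g by (rule comp_hom)
  have "f = \<rho> (f \<cdot> g) \<cdot> f" using comp_rst[OF f g] f total by simp
  then have "\<rho> f = \<rho> (f \<cdot> g) \<cdot> \<rho> f" using rst_rst_comp[OF f fg] by simp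
  also have "\<dots> = \<rho> (\<rho> f \<cdot> (f \<cdot> g))"
    using rst_commute[OF f fg] rst_rst_comp[OF fg f] by simp
  also have "\<rho> f \<cdot> (f \<cdot> g) = f \<cdot> g"
    using f g by (simp add: comp_reassoc[OF rst_comp_self])
  finally show ?thesis by simp
qed

lemma restriction_le_antisym:
  assumes f: "f \<in> hom C A B" and g: "g \<in> hom C A B"
    and "\<rho> f \<cdot> g = f" and "\<rho> g \<cdot> f = g"
  shows "f = g"
proof -
  have "f = \<rho> f \<cdot> \<rho> g \<cdot> f" using assms by simp
  also have "\<dots> = \<rho> g \<cdot> \<rho> f \<cdot> f" using rst_commute[OF f g] by simp
  also have "\<dots> = g" using assms by simp
  finally show ?thesis .
qed

end

section \<open>Finite coproducts\<close>

context cocartesian_restriction_category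
begin

lemma coprod_in_Ob [simp]: "set As \<subseteq> Ob C \<Longrightarrow> \<Oplus> As \<in> Ob C"
  by (rule coprod_Ob)

lemma inj_arr [simp]:
  assumes "set As \<subseteq> Ob C" "i < length As"
  shows "inj\<^sub>c As i \<in> Mor C" "Dom C (inj\<^sub>c As i) = As ! i" "Cod C (inj\<^sub>c As i) = \<Oplus> As"
  using inj_hom[OF assms] by simp_all

lemma rst_inj [simp]:
  assumes "set As \<subseteq> Ob C" "i < length As"
  shows "\<rho> (inj\<^sub>c As i) = \<one> (As ! i)"
  using inj_total[OF assms] assms by (simp add: total_map_def)

lemma coprod_universal_family:
  assumes "set As \<subseteq> Ob C" "B \<in> Ob C" "\<And>i. i < length As \<Longrightarrow> f i \<in> hom C (As ! i) B"
  shows "\<exists>!h. h \<in> hom C (\<Oplus> As) B \<and> (\<forall>i < length As. inj\<^sub>c As i \<cdot> h = f i)"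
  using coprod_universal[of As B "map f [0..<length As]"] assms by simp

lemma coprod_ext:
  assumes As: "set As \<subseteq> Ob C" and h: "h \<in> hom C (\<Oplus> As) B" and h': "h' \<in> hom C (\<Oplus> As) B"
    and eq: "\<And>i. i < length As \<Longrightarrow> inj\<^sub>c As i \<cdot> h = inj\<^sub>c As i \<cdot> h'"
  shows "h = h'"
proof -
  have "\<exists>!k. k \<in> hom C (\<Oplus> As) B \<and> (\<forall>i < length As. inj\<^sub>c As i \<cdot> k = inj\<^sub>c As i \<cdot> h)"
    by (rule coprod_universal_family) (use As h in simp_all)
  then show ?thesis using h h' eq by metis
qed

lemma cotuple_universal:
  assumes fs: "fs \<in> homs C As (replicate (length As) B)" and B: "B \<in> Ob C"
  shows "cotuple C B fs \<in> hom C (\<Oplus> As) B \<and>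
    (\<forall>i < length As. inj\<^sub>c As i \<cdot> cotuple C B fs = fs ! i)"
proof -
  have "\<exists>!h. h \<in> hom C (\<Oplus> As) B \<and> (\<forall>i < length As. inj\<^sub>c As i \<cdot> h = fs ! i)"
    using fs homs_Ob[OF fs] by (intro coprod_universal_family) (auto simp: homs_def B)
  from theI'[OF this] show ?thesis
    using fs homs_map_Dom[OF fs] by (simp add: cotuple_def homs_def del: in_hom_iff)
qed

lemma cotuple_arr [simp]:
  assumes "fs \<in> homs C (map (Dom C) fs) (replicate (length fs) B)" "B \<in> Ob C"
  shows "cotuple C B fs \<in> Mor C" "Dom C (cotuple C B fs) = \<Oplus> (map (Dom C) fs)"
    "Cod C (cotuple C B fs) = B"
  using cotuple_universal[of fs "map (Dom C) fs" B] assms by simp_all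

lemma inj_cotuple [simp]:
  assumes "fs \<in> homs C As (replicate (length As) B)" "B \<in> Ob C" "i < length As"
  shows "inj\<^sub>c As i \<cdot> cotuple C B fs = fs ! i"
  using cotuple_universal assms by blast

declare inj_cotuple [THEN comp_reassoc, simp]

lemma map_sum_universal:
  assumes fs: "fs \<in> homs C As Bs"
  shows "map_sum C fs \<in> hom C (\<Oplus> As) (\<Oplus> Bs) \<and>
    (\<forall>i < length As. inj\<^sub>c As i \<cdot> map_sum C fs = fs ! i \<cdot> inj\<^sub>c Bs i)"
proof -
  have lens: "length fs = length As" "length Bs = length As" using fs by (simp_all add: homs_def)
  let ?gs = "map (\<lambda>i. fs ! i \<cdot> inj\<^sub>c Bs i) [0..<length fs]"
  have "?gs \<in> homs C As (replicate (length As) (\<Oplus> Bs))"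
    using fs homs_Ob[OF fs] by (auto simp: homs_def)
  from cotuple_universal[OF this] show ?thesis
    using homs_Ob[OF fs] lens by (simp add: map_sum_def homs_map_Cod[OF fs])
qed

lemma map_sum_arr [simp]:
  assumes "fs \<in> homs C (map (Dom C) fs) (map (Cod C) fs)"
  shows "map_sum C fs \<in> Mor C" "Dom C (map_sum C fs) = \<Oplus> (map (Dom C) fs)"
    "Cod C (map_sum C fs) = \<Oplus> (map (Cod C) fs)"
  using map_sum_universal[OF assms] by simp_all

lemma inj_map_sum:
  assumes "fs \<in> homs C As Bs" "i < length As"
  shows "inj\<^sub>c As i \<cdot> map_sum C fs = fs ! i \<cdot> inj\<^sub>c Bs i"
  using map_sum_universal assms by blast

lemma map_sum_comp:
  assumes fs: "fs \<in> homs C As Bs" and gs: "gs \<in> homs C Bs Ds" and hs: "hs \<in> homs C As Ds"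
    and comp: "\<And>i. i < length As \<Longrightarrow> fs ! i \<cdot> gs ! i = hs ! i"
  shows "map_sum C fs \<cdot> map_sum C gs = map_sum C hs"
proof (rule coprod_ext)
  note obs = homs_Ob[OF fs] homs_Ob[OF gs]
    and maps = map_sum_universal[OF fs] map_sum_universal[OF gs] map_sum_universal[OF hs]
  show "set As \<subseteq> Ob C" using obs by simp
  show "map_sum C fs \<cdot> map_sum C gs \<in> hom C (\<Oplus> As) (\<Oplus> Ds)"
    "map_sum C hs \<in> hom C (\<Oplus> As) (\<Oplus> Ds)"
    using maps by simp_all
  fix i assume i: "i < length As"
  then have i': "i < length Bs" "i < length Ds" using fs hs by (simp_all add: homs_def)
  have "inj\<^sub>c As i \<cdot> (map_sum C fs \<cdot> map_sum C gs) = fs ! i \<cdot> inj\<^sub>c Bs i \<cdot> map_sum C gs"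
    using maps obs i by (intro comp_reassoc) (simp_all add: inj_map_sum[OF fs])
  also have "\<dots> = fs ! i \<cdot> gs ! i \<cdot> inj\<^sub>c Ds i"
    using maps obs homs_nth[OF fs i] homs_nth[OF gs i'(1)] i' by (simp add: inj_map_sum[OF gs])
  finally show "inj\<^sub>c As i \<cdot> (map_sum C fs \<cdot> map_sum C gs) = inj\<^sub>c As i \<cdot> map_sum C hs"
    using i by (simp add: comp inj_map_sum[OF hs])
qed

lemma map_sum_id:
  assumes "set As \<subseteq> Ob C"
  shows "map_sum C (map \<one> As) = \<one> (\<Oplus> As)"
proof (rule coprod_ext)
  have ids: "map \<one> As \<in> homs C As As"
    using assms by (auto simp: homs_def)
  show "map_sum C (map \<one> As) \<in> hom C (\<Oplus> As) (\<Oplus> As)" using map_sum_universal[OF ids] by simp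
  show "inj\<^sub>c As i \<cdot> map_sum C (map \<one> As) = inj\<^sub>c As i \<cdot> \<one> (\<Oplus> As)" if "i < length As" for i
    using assms that by (auto simp: inj_map_sum[OF ids])
qed (use assms in simp_all)

lemma rst_cotuple:
  assumes fs: "fs \<in> homs C As (replicate (length As) B)" and B: "B \<in> Ob C"
  shows "\<rho> (cotuple C B fs) = map_sum C (map \<rho> fs)"
proof (rule coprod_ext)
  note cotuple = cotuple_universal[OF fs B]
  have rsts: "map \<rho> fs \<in> homs C As As" using fs by (simp add: homs_def)
  show "set As \<subseteq> Ob C" using homs_Ob[OF fs] by simp
  show "\<rho> (cotuple C B fs) \<in> hom C (\<Oplus> As) (\<Oplus> As)" using cotuple by simp
  show "map_sum C (map \<rho> fs) \<in> hom C (\<Oplus> As) (\<Oplus> As)" using map_sum_universal[OF rsts] by simp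
  show "inj\<^sub>c As i \<cdot> \<rho> (cotuple C B fs) = inj\<^sub>c As i \<cdot> map_sum C (map \<rho> fs)" if "i < length As" for i
    using cotuple homs_Ob[OF fs] that fs by (simp add: comp_rst_arr inj_map_sum[OF rsts] homs_def)
qed

lemma rst_map_sum:
  assumes fs: "fs \<in> homs C As Bs"
  shows "\<rho> (map_sum C fs) = map_sum C (map \<rho> fs)"
proof -
  note obs = homs_Ob[OF fs]
  let ?gs = "map (\<lambda>i. fs ! i \<cdot> inj\<^sub>c Bs i) [0..<length fs]"
  have "?gs \<in> homs C As (replicate (length As) (\<Oplus> Bs))"
    using fs obs by (auto simp: homs_def)
  moreover have "map \<rho> ?gs = map \<rho> fs"
    using fs obs by (intro nth_equalityI) (auto simp: homs_def intro!: rst_comp_total)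
  ultimately show ?thesis
    using rst_cotuple[of ?gs As "\<Oplus> Bs"] obs by (simp add: map_sum_def homs_map_Cod[OF fs])
qed

lemma codiag_universal:
  assumes "A \<in> Ob C"
  shows "codiag C n A \<in> hom C (\<Oplus> (replicate n A)) A"
    and "i < n \<Longrightarrow> inj\<^sub>c (replicate n A) i \<cdot> codiag C n A = \<one> A"
  using cotuple_universal[of "replicate n (\<one> A)" "replicate n A" A] assms
  by (simp_all add: codiag_def homs_def)

lemma codiag_arr [simp]:
  assumes "A \<in> Ob C"
  shows "codiag C n A \<in> Mor C" "Dom C (codiag C n A) = \<Oplus> (replicate n A)" "Cod C (codiag C n A) = A"
  using codiag_universal[OF assms] by simp_all

lemma rst_codiag:
  assumes "A \<in> Ob C"
  shows "\<rho> (codiag C n A) = \<one> (\<Oplus> (replicate n A))"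
  using rst_cotuple[of "replicate n (\<one> A)" "replicate n A" A] map_sum_id[of "replicate n A"] assms
  by (simp add: codiag_def homs_def)

end

section \<open>Quasi-projections and decisions\<close>

context extensive_restriction_category
begin

lemma zero_arr [simp]:
  assumes "A \<in> Ob C" "B \<in> Ob C"
  shows "\<zero> A B \<in> Mor C" "Dom C (\<zero> A B) = A" "Cod C (\<zero> A B) = B"
  using zero_hom[OF assms] by simp_all

lemma zero_comp_arr [simp]:
  "f \<in> Mor C \<Longrightarrow> Dom C f = B \<Longrightarrow> A \<in> Ob C \<Longrightarrow> \<zero> A B \<cdot> f = \<zero> A (Cod C f)"
  by (rule zero_comp) auto

lemma comp_zero_arr [simp]:
  "f \<in> Mor C \<Longrightarrow> Cod C f = B \<Longrightarrow> D \<in> Ob C \<Longrightarrow> f \<cdot> \<zero> B D = \<zero> (Dom C f) D"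
  by (rule comp_zero) auto

lemma quasi_proj_universal:
  assumes As: "set As \<subseteq> Ob C" and j: "j < length As"
  shows "quasi_proj C As j \<in> hom C (\<Oplus> As) (As ! j) \<and> (\<forall>i < length As.
    inj\<^sub>c As i \<cdot> quasi_proj C As j = (if i = j then \<one> (As ! j) else \<zero> (As ! i) (As ! j)))"
proof -
  let ?P = "\<lambda>q. q \<in> hom C (\<Oplus> As) (As ! j) \<and>
    (\<forall>i < length As. inj\<^sub>c As i \<cdot> q = (if i = j then \<one> (As ! j) else \<zero> (As ! i) (As ! j)))"
  have unique: "\<exists>!q. ?P q"
    by (rule coprod_universal_family) (use As j in simp_all)
  have eq: "quasi_proj C As j = (THE q. ?P q)"
    unfolding quasi_proj_def by (rule arg_cong[where f = The]) (use j in auto)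
  show ?thesis unfolding eq by (rule theI'[OF unique])
qed

lemma quasi_proj_arr [simp]:
  assumes "set As \<subseteq> Ob C" "j < length As"
  shows "quasi_proj C As j \<in> Mor C" "Dom C (quasi_proj C As j) = \<Oplus> As"
    "Cod C (quasi_proj C As j) = As ! j"
  using quasi_proj_universal[OF assms] by simp_all

lemma inj_quasi_proj [simp]:
  assumes "set As \<subseteq> Ob C" "i < length As" "j < length As"
  shows "inj\<^sub>c As i \<cdot> quasi_proj C As j = (if i = j then \<one> (As ! j) else \<zero> (As ! i) (As ! j))"
  using quasi_proj_universal assms by blast

declare inj_quasi_proj [THEN comp_reassoc, simp]

lemma map_sum_quasi_proj:
  assumes fs: "fs \<in> homs C As Bs" and i: "i < length As"
  shows "map_sum C fs \<cdot> quasi_proj C Bs i = quasi_proj C As i \<cdot> fs ! i"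
proof (rule coprod_ext)
  note obs = homs_Ob[OF fs] and sum = map_sum_universal[OF fs]
  have len: "length Bs = length As" using fs by (simp add: homs_def)
  show "set As \<subseteq> Ob C" using obs by simp
  show "map_sum C fs \<cdot> quasi_proj C Bs i \<in> hom C (\<Oplus> As) (Bs ! i)"
    "quasi_proj C As i \<cdot> fs ! i \<in> hom C (\<Oplus> As) (Bs ! i)"
    using obs sum homs_nth[OF fs i] i len by simp_all
  fix j assume j: "j < length As"
  have "inj\<^sub>c As j \<cdot> (map_sum C fs \<cdot> quasi_proj C Bs i) = fs ! j \<cdot> inj\<^sub>c Bs j \<cdot> quasi_proj C Bs i"
    using sum obs i j len by (intro comp_reassoc) (simp_all add: inj_map_sum[OF fs])
  also have "\<dots> = inj\<^sub>c As j \<cdot> (quasi_proj C As i \<cdot> fs ! i)"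
    using obs homs_nth[OF fs i] homs_nth[OF fs j] i j len  by simp
  finally show "inj\<^sub>c As j \<cdot> (map_sum C fs \<cdot> quasi_proj C Bs i) =
    inj\<^sub>c As j \<cdot> (quasi_proj C As i \<cdot> fs ! i)" .
qed

lemma rst_quasi_proj:
  assumes As: "set As \<subseteq> Ob C" and i: "i < length As"
  shows "\<rho> (quasi_proj C As i) = quasi_proj C As i \<cdot> inj\<^sub>c As i"
proof (rule coprod_ext)
  show "inj\<^sub>c As j \<cdot> \<rho> (quasi_proj C As i) = inj\<^sub>c As j \<cdot> (quasi_proj C As i \<cdot> inj\<^sub>c As i)"
    if "j < length As" for j
    using As i that by (simp add: comp_rst_arr rst_zero)
qed (use assms in auto)

lemma
  assumes "decides C Bs f e" "f \<in> hom C A (\<Oplus> Bs)"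
  shows decides_hom: "e \<in> hom C A (\<Oplus> (replicate (length Bs) A))"
    and decides_codiag: "e \<cdot> codiag C (length Bs) A = \<rho> f"
    and decides_map_sum_replicate:
      "e \<cdot> map_sum C (replicate (length Bs) f) = f \<cdot> map_sum C (map (inj\<^sub>c Bs) [0..<length Bs])"
  using assms by (simp_all add: decides_def)

lemma replicate_in_homs: "f \<in> hom C A B \<Longrightarrow> replicate n f \<in> homs C (replicate n A) (replicate n B)"
  by (simp add: homs_def)

lemma injs_in_homs:
  assumes "set Bs \<subseteq> Ob C"
  shows "map (inj\<^sub>c Bs) [0..<length Bs] \<in> homs C Bs (replicate (length Bs) (\<Oplus> Bs))"
  using assms by (simp add: homs_def)

lemma decides_comp_quasi_proj_comp:
  assumes Bs: "set Bs \<subseteq> Ob C" and f: "f \<in> hom C A (\<Oplus> Bs)" and e: "decides C Bs f e"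
    and i: "i < length Bs"
  shows "e \<cdot> quasi_proj C (replicate (length Bs) A) i \<cdot> f = f \<cdot> quasi_proj C Bs i \<cdot> inj\<^sub>c Bs i"
proof -
  let ?n = "length Bs"
  let ?q = "quasi_proj C (replicate ?n (\<Oplus> Bs)) i"
  note copies = replicate_in_homs[OF f, of ?n] and injs = injs_in_homs[OF Bs]
    and e_hom = decides_hom[OF e f]
  have "e \<cdot> quasi_proj C (replicate ?n A) i \<cdot> f = e \<cdot> (map_sum C (replicate ?n f) \<cdot> ?q)"
    using f e_hom i by (simp add: map_sum_quasi_proj[OF copies])
  also have "\<dots> = f \<cdot> map_sum C (map (inj\<^sub>c Bs) [0..<?n]) \<cdot> ?q"
    using f e_hom i map_sum_universal[OF copies]
    by (intro comp_reassoc[OF decides_map_sum_replicate[OF e f]]) simp_all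
  also have "\<dots> = f \<cdot> quasi_proj C Bs i \<cdot> inj\<^sub>c Bs i"
    using f Bs i map_sum_universal[OF injs] by (simp add: map_sum_quasi_proj[OF injs])
  finally show ?thesis .
qed

lemma decides_comp_quasi_proj:
  assumes Bs: "set Bs \<subseteq> Ob C" and f: "f \<in> hom C A (\<Oplus> Bs)" and e: "decides C Bs f e"
    and i: "i < length Bs"
  shows "e \<cdot> quasi_proj C (replicate (length Bs) A) i = \<rho> (f \<cdot> quasi_proj C Bs i)"
proof -
  let ?As = "replicate (length Bs) A"
  let ?q = "quasi_proj C ?As i" and ?codiag = "codiag C (length Bs) A"
  have A: "A \<in> Ob C" using f by simp
  note e_hom = decides_hom[OF e f]
  have q: "?q \<in> hom C (\<Oplus> ?As) A" and eq: "e \<cdot> ?q \<in> hom C A A" using e_hom A i by simp_all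
  have "?q = \<rho> ?q \<cdot> ?codiag"
    using A i by (simp add: rst_quasi_proj codiag_universal)
  then have "e \<cdot> ?q = e \<cdot> \<rho> ?q \<cdot> ?codiag"
    using e_hom q A by simp
  also have "\<dots> = \<rho> (e \<cdot> ?q) \<cdot> \<rho> f"
    using e_hom q A by (simp add: comp_rst[OF e_hom q] decides_codiag[OF e f])
  finally have eq_rst: "e \<cdot> ?q = \<rho> (e \<cdot> ?q) \<cdot> \<rho> f" .
  also have "\<dots> = \<rho> (\<rho> (e \<cdot> ?q) \<cdot> f)" by (rule rst_rst_comp[OF f eq, symmetric])
  also have "\<rho> (e \<cdot> ?q) \<cdot> f = e \<cdot> ?q \<cdot> f"
    using f eq by (subst (2) eq_rst) simp
  also have "\<dots> = f \<cdot> quasi_proj C Bs i \<cdot> inj\<^sub>c Bs i"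
    by (rule decides_comp_quasi_proj_comp[OF Bs f e i])
  also have "\<rho> \<dots> = \<rho> (f \<cdot> quasi_proj C Bs i)"
    using f Bs i by (intro rst_comp_total) auto
  finally show ?thesis .
qed

definition components :: "'a list \<Rightarrow> 'b \<Rightarrow> 'b list" where
  "components Bs f = map (\<lambda>i. f \<cdot> quasi_proj C Bs i) [0..<length Bs]"

lemma length_components [simp]: "length (components Bs f) = length Bs"
  by (simp add: components_def)

lemma nth_components [simp]: "i < length Bs \<Longrightarrow> components Bs f ! i = f \<cdot> quasi_proj C Bs i"
  by (simp add: components_def)

lemma components_in_homs:
  assumes "set Bs \<subseteq> Ob C" "f \<in> hom C A (\<Oplus> Bs)"
  shows "components Bs f \<in> homs C (replicate (length Bs) A) Bs"
  using assms by (simp add: homs_def)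

lemma rst_components_in_homs:
  assumes "set Bs \<subseteq> Ob C" "f \<in> hom C A (\<Oplus> Bs)"
  shows "map \<rho> (components Bs f) \<in> homs C (replicate (length Bs) A) (replicate (length Bs) A)"
  using assms by (simp add: homs_def)

lemma decides_map_sum_components:
  assumes Bs: "set Bs \<subseteq> Ob C" and f: "f \<in> hom C A (\<Oplus> Bs)" and e: "decides C Bs f e"
  shows "e \<cdot> map_sum C (components Bs f) = f"
proof -
  let ?n = "length Bs"
  let ?projs = "map (quasi_proj C Bs) [0..<?n]"
  have projs: "?projs \<in> homs C (replicate ?n (\<Oplus> Bs)) Bs" and ids: "map \<one> Bs \<in> homs C Bs Bs"
    using Bs by (simp_all add: homs_def)
  note copies = replicate_in_homs[OF f, of ?n] and injs = injs_in_homs[OF Bs]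
    and e_hom = decides_hom[OF e f]
  note maps = map_sum_universal[OF copies] map_sum_universal[OF injs] map_sum_universal[OF projs]
  have "map_sum C (components Bs f) = map_sum C (replicate ?n f) \<cdot> map_sum C ?projs"
    by (rule map_sum_comp[OF copies projs components_in_homs[OF Bs f], symmetric])
      simp
  then have "e \<cdot> map_sum C (components Bs f) = e \<cdot> (map_sum C (replicate ?n f) \<cdot> map_sum C ?projs)"
    by simp
  also have "\<dots> = f \<cdot> map_sum C (map (inj\<^sub>c Bs) [0..<?n]) \<cdot> map_sum C ?projs"
    using f e_hom maps by (intro comp_reassoc[OF decides_map_sum_replicate[OF e f]]) simp_all
  also have "\<dots> = f \<cdot> map_sum C (map \<one> Bs)"
    using f maps Bs map_sum_comp[OF injs projs ids] by simp
  finally show ?thesis using f Bs by (simp add: map_sum_id)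
qed

lemma decides_map_sum_rst_components:
  assumes Bs: "set Bs \<subseteq> Ob C" and f: "f \<in> hom C A (\<Oplus> Bs)" and e: "decides C Bs f e"
  shows "e \<cdot> map_sum C (map \<rho> (components Bs f)) = e"
proof -
  note components = components_in_homs[OF Bs f] and e_hom = decides_hom[OF e f]
  have "\<rho> f = \<rho> (\<rho> f)" using f by simp
  also have "\<dots> = \<rho> (e \<cdot> codiag C (length Bs) A)" by (simp only: decides_codiag[OF e f])
  also have "\<dots> = \<rho> e" using e_hom by (intro rst_comp_total) (auto simp: rst_codiag)
  finally have rst_f: "\<rho> f = \<rho> e" .
  have "e \<cdot> map_sum C (map \<rho> (components Bs f)) = e \<cdot> \<rho> (map_sum C (components Bs f))"
    by (simp only: rst_map_sum[OF components])
  also have "\<dots> = \<rho> (e \<cdot> map_sum C (components Bs f)) \<cdot> e"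
    using e_hom map_sum_universal[OF components] by (intro comp_rst_arr) auto
  also have "\<dots> = e"
    using e_hom by (simp add: decides_map_sum_components[OF Bs f e] rst_f)
  finally show ?thesis .
qed

lemma map_sum_components:
  assumes Bs: "set Bs \<subseteq> Ob C" and f: "f \<in> hom C A (\<Oplus> Bs)"
  shows "map_sum C (components Bs f) =
    map_sum C (map \<rho> (components Bs f)) \<cdot> (codiag C (length Bs) A \<cdot> f)"
proof (rule coprod_ext)
  let ?As = "replicate (length Bs) A" and ?codiag = "codiag C (length Bs) A"
  note components = components_in_homs[OF Bs f] and rsts = rst_components_in_homs[OF Bs f]
  note maps = map_sum_universal[OF components] map_sum_universal[OF rsts]
  show "set ?As \<subseteq> Ob C" using f by simp
  show "map_sum C (components Bs f) \<in> hom C (\<Oplus> ?As) (\<Oplus> Bs)"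
    "map_sum C (map \<rho> (components Bs f)) \<cdot> (?codiag \<cdot> f) \<in> hom C (\<Oplus> ?As) (\<Oplus> Bs)"
    using maps f by simp_all
  obtain e where e: "decides C Bs f e" using decision_exists[OF Bs f] by blast
  fix i assume "i < length ?As"
  then have i: "i < length Bs" by simp
  have "inj\<^sub>c ?As i \<cdot> map_sum C (components Bs f) = f \<cdot> quasi_proj C Bs i \<cdot> inj\<^sub>c Bs i"
    using i by (simp add: inj_map_sum[OF components])
  also have "\<dots> = e \<cdot> quasi_proj C ?As i \<cdot> f"
    by (rule decides_comp_quasi_proj_comp[OF Bs f e i, symmetric])
  also have "\<dots> = \<rho> (f \<cdot> quasi_proj C Bs i) \<cdot> f"
    by (simp only: decides_comp_quasi_proj[OF Bs f e i])
  also have "\<dots> = \<rho> (f \<cdot> quasi_proj C Bs i) \<cdot> inj\<^sub>c ?As i \<cdot> (?codiag \<cdot> f)"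
    using f Bs i by (simp add: comp_reassoc[OF codiag_universal(2)])
  also have "\<dots> = inj\<^sub>c ?As i \<cdot> (map_sum C (map \<rho> (components Bs f)) \<cdot> (?codiag \<cdot> f))"
    using f Bs i maps
    by (intro comp_reassoc[symmetric]) (simp_all add: inj_map_sum[OF rsts])
  finally show "inj\<^sub>c ?As i \<cdot> map_sum C (components Bs f) =
    inj\<^sub>c ?As i \<cdot> (map_sum C (map \<rho> (components Bs f)) \<cdot> (?codiag \<cdot> f))" .
qed

lemma restriction_le_if_components_eq:
  assumes Bs: "set Bs \<subseteq> Ob C" and f: "f \<in> hom C A (\<Oplus> Bs)" and g: "g \<in> hom C A (\<Oplus> Bs)"
    and eq: "components Bs f = components Bs g"
  shows "\<rho> f \<cdot> g = f"
proof -
  let ?codiag = "codiag C (length Bs) A"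
  obtain e where e: "decides C Bs f e" using decision_exists[OF Bs f] by blast
  note e_hom = decides_hom[OF e f] and rsts = map_sum_universal[OF rst_components_in_homs[OF Bs f]]
  have "f = e \<cdot> map_sum C (components Bs g)"
    using decides_map_sum_components[OF Bs f e] by (simp only: eq)
  also have "\<dots> = e \<cdot> (map_sum C (map \<rho> (components Bs f)) \<cdot> (?codiag \<cdot> g))"
    by (simp only: map_sum_components[OF Bs g] eq)
  also have "\<dots> = e \<cdot> (?codiag \<cdot> g)"
    using e_hom f g rsts
    by (intro comp_reassoc[OF decides_map_sum_rst_components[OF Bs f e]]) simp_all
  also have "\<dots> = \<rho> f \<cdot> g"
    using f g e_hom by (intro comp_reassoc[OF decides_codiag[OF e f]]) simp_all
  finally show ?thesis by simp
qed

lemma quasi_proj_jointly_monic: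
  assumes Bs: "set Bs \<subseteq> Ob C" and f: "f \<in> hom C A (\<Oplus> Bs)" and g: "g \<in> hom C A (\<Oplus> Bs)"
    and eq: "\<And>i. i < length Bs \<Longrightarrow> f \<cdot> quasi_proj C Bs i = g \<cdot> quasi_proj C Bs i"
  shows "f = g"
proof (rule restriction_le_antisym[OF f g])
  have components: "components Bs f = components Bs g" by (simp add: components_def eq)
  show "\<rho> f \<cdot> g = f" by (rule restriction_le_if_components_eq[OF Bs f g components])
  show "\<rho> g \<cdot> f = g" by (rule restriction_le_if_components_eq[OF Bs g f components[symmetric]])
qed

lemma decides_unique:
  assumes Bs: "set Bs \<subseteq> Ob C" and f: "f \<in> hom C A (\<Oplus> Bs)"
    and d: "decides C Bs f d" and e: "decides C Bs f e"
  shows "d = e"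
proof (rule quasi_proj_jointly_monic)
  let ?As = "replicate (length Bs) A"
  show "d \<in> hom C A (\<Oplus> ?As)" "e \<in> hom C A (\<Oplus> ?As)"
    using decides_hom d e f by blast+
  show "d \<cdot> quasi_proj C ?As i = e \<cdot> quasi_proj C ?As i" if "i < length ?As" for i
    using that
    by (simp add: decides_comp_quasi_proj[OF Bs f d] decides_comp_quasi_proj[OF Bs f e])
qed (use f in simp)

lemma decides_self:
  assumes Bs: "set Bs \<subseteq> Ob C" and f: "f \<in> hom C A (\<Oplus> Bs)" and e: "decides C Bs f e"
  shows "decides C (replicate (length Bs) A) e e"
proof -
  let ?As = "replicate (length Bs) A"
  have As: "set ?As \<subseteq> Ob C" using f by simp
  note e_hom = decides_hom[OF e f]
  obtain d where d: "decides C ?As e d" using decision_exists[OF As e_hom] by blast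
  have "d = e"
  proof (rule quasi_proj_jointly_monic[OF As _ e_hom])
    show "d \<in> hom C A (\<Oplus> ?As)" using decides_hom[OF d e_hom] by simp
    show "d \<cdot> quasi_proj C ?As i = e \<cdot> quasi_proj C ?As i" if "i < length ?As" for i
      using decides_comp_quasi_proj[OF As e_hom d that] decides_comp_quasi_proj[OF Bs f e, of i]
        f Bs that
      by simp
  qed
  with d show ?thesis by simp
qed

lemma is_decision_iff:
  "is_decision C n A d \<longleftrightarrow>
    d \<in> hom C A (\<Oplus> (replicate n A)) \<and> decides C (replicate n A) d d"
proof (cases "d \<in> hom C A (\<Oplus> (replicate n A))")
  case True
  then have As: "set (replicate n A) \<subseteq> Ob C" by simp
  obtain e where e: "decides C (replicate n A) d e" using decision_exists[OF As True] by blast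
  have "decision_of C (replicate n A) d = e"
    unfolding decision_of_def using e decides_unique[OF As True] by blast
  then show ?thesis
    using True e decides_unique[OF As True] by (auto simp: is_decision_def)
qed (simp add: is_decision_def del: in_hom_iff)

end

section \<open>Disjointness and matrices\<close>

lemma replicate_two [simp]: "replicate 2 x = [x, x]"
  by (simp add: numeral_2_eq_2)

context cocartesian_restriction_category
begin

text \<open>The simplifier rewrites \<open>1\<close> to \<open>Suc 0\<close>, so rules about index \<open>1\<close> would never match.\<close>

abbreviation inl where "inl A B \<equiv> inj\<^sub>c [A, B] 0"
abbreviation inr where "inr A B \<equiv> inj\<^sub>c [A, B] (Suc 0)"

text \<open>
  As a rewrite rule this needs \<open>Bs\<close> to be a function of \<open>fs\<close>. It is suited to enumerated lists only,
  since \<open>map (Cod C) fs\<close> does not simplify otherwise.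
\<close>

declare inj_map_sum [where fs = fs and Bs = "map (Cod C) fs" for fs, simp]
  inj_map_sum [where fs = fs and Bs = "map (Cod C) fs" for fs, THEN comp_reassoc, simp]

lemma coprod_ext_binary:
  assumes "A \<in> Ob C" "B \<in> Ob C" "h \<in> hom C (\<Oplus> [A, B]) D" "h' \<in> hom C (\<Oplus> [A, B]) D"
    and "inl A B \<cdot> h = inl A B \<cdot> h'" "inr A B \<cdot> h = inr A B \<cdot> h'"
  shows "h = h'"
  by (rule coprod_ext[of "[A, B]"]) (use assms in \<open>auto simp: less_Suc_eq\<close>)

lemma coprod_ext_nested:
  assumes A: "A \<in> Ob C" and B: "B \<in> Ob C" and D: "D \<in> Ob C"
    and h: "h \<in> hom C (\<Oplus> [\<Oplus> [A, B], D]) E" and h': "h' \<in> hom C (\<Oplus> [\<Oplus> [A, B], D]) E"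
    and "inl A B \<cdot> (inl (\<Oplus> [A, B]) D \<cdot> h) = inl A B \<cdot> (inl (\<Oplus> [A, B]) D \<cdot> h')"
    and "inr A B \<cdot> (inl (\<Oplus> [A, B]) D \<cdot> h) = inr A B \<cdot> (inl (\<Oplus> [A, B]) D \<cdot> h')"
    and r: "inr (\<Oplus> [A, B]) D \<cdot> h = inr (\<Oplus> [A, B]) D \<cdot> h'"
  shows "h = h'"
proof (rule coprod_ext_binary[OF _ D h h' _ r])
  show "inl (\<Oplus> [A, B]) D \<cdot> h = inl (\<Oplus> [A, B]) D \<cdot> h'"
    by (rule coprod_ext_binary[of A B _ E]) (use assms in simp_all)
qed (use A B in simp)

lemma codiag_two: "codiag C 2 A = cotuple C A [\<one> A, \<one> A]"
  by (simp add: codiag_def)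

lemma map_sum_codiag:
  assumes "f \<in> hom C A D" "g \<in> hom C B D"
  shows "map_sum C [f, g] \<cdot> codiag C 2 D = cotuple C D [f, g]"
  by (rule coprod_ext_binary[of A B _ D]) (use assms in \<open>simp_all add: codiag_two\<close>)

end

context extensive_restriction_category
begin

abbreviation prl where "prl A B \<equiv> quasi_proj C [A, B] 0"
abbreviation prr where "prr A B \<equiv> quasi_proj C [A, B] (Suc 0)"

declare map_sum_quasi_proj [where fs = fs and As = "map (Dom C) fs" for fs, simp]

lemma separates_iff:
  assumes "f \<in> hom C A B"
  shows "separates C f g d \<longleftrightarrow> d \<in> hom C A (\<Oplus> [A, A]) \<and> decides C [A, A] d d \<and>
    d \<cdot> prl A A = \<rho> f \<and> d \<cdot> prr A A = \<rho> g"
  using assms by (auto simp: separates_def is_decision_iff)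

lemma quasi_proj_jointly_monic_binary:
  assumes "B \<in> Ob C" "D \<in> Ob C" "f \<in> hom C A (\<Oplus> [B, D])" "g \<in> hom C A (\<Oplus> [B, D])"
    and "f \<cdot> prl B D = g \<cdot> prl B D" "f \<cdot> prr B D = g \<cdot> prr B D"
  shows "f = g"
  by (rule quasi_proj_jointly_monic[of "[B, D]"]) (use assms in \<open>auto simp: less_Suc_eq\<close>)

lemma separator_eq:
  assumes f: "f \<in> hom C A B" and d: "separates C f g d"
  shows "separator C f g = d"
  unfolding separator_def
proof (rule the_equality)
  show "separates C f g d" by (rule d)
  show "d' = d" if "separates C f g d'" for d'
    using quasi_proj_jointly_monic_binary[of A A d' A d] d that f by (simp add: separates_iff[OF f])
qed

lemma
  assumes f: "f \<in> hom C A B" and g: "g \<in> hom C A D" and fg: "f \<bottom> g"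
  shows row_hom: "row C f g \<in> hom C A (\<Oplus> [B, D])"
    and row_prl: "row C f g \<cdot> prl B D = f" and row_prr: "row C f g \<cdot> prr B D = g"
proof -
  obtain d where d: "separates C f g d" using fg by (auto simp: dperp_def)
  then have d_hom: "d \<in> hom C A (\<Oplus> [A, A])" and dl: "d \<cdot> prl A A = \<rho> f" and dr: "d \<cdot> prr A A = \<rho> g"
    using separates_iff[OF f] by auto
  have row: "row C f g = d \<cdot> map_sum C [f, g]" by (simp add: row_def separator_eq[OF f d])
  show "row C f g \<in> hom C A (\<Oplus> [B, D])" using f g d_hom by (simp add: row)
  show "row C f g \<cdot> prl B D = f" "row C f g \<cdot> prr B D = g"
    using f g d_hom by (simp_all add: row comp_reassoc[OF dl] comp_reassoc[OF dr])
qed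

lemmas row_components = row_hom row_prl row_prr

lemma
  assumes h: "h \<in> hom C A (\<Oplus> [B, D])" and B: "B \<in> Ob C" and D: "D \<in> Ob C"
    and f: "h \<cdot> prl B D = f" and g: "h \<cdot> prr B D = g"
  shows perpI: "f \<bottom> g" and row_eqI: "row C f g = h"
proof -
  have BD: "set [B, D] \<subseteq> Ob C" using B D by simp
  have f_hom: "f \<in> hom C A B" and g_hom: "g \<in> hom C A D"
    using h B D unfolding f[symmetric] g[symmetric] by simp_all
  obtain e where e: "decides C [B, D] h e" using decision_exists[OF BD h] by blast
  have "separates C f g e"
    using decides_self[OF BD h e] decides_comp_quasi_proj[OF BD h e, of 0]
      decides_comp_quasi_proj[OF BD h e, of "Suc 0"] e h f g
    by (simp add: separates_iff[OF f_hom] decides_def)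
  then show perp: "f \<bottom> g" using f_hom g_hom by (auto simp: dperp_def)
  show "row C f g = h"
    by (rule quasi_proj_jointly_monic_binary[OF B D row_hom[OF f_hom g_hom perp] h])
      (simp_all only: row_components[OF f_hom g_hom perp] f g)
qed

lemma
  assumes f: "f \<in> hom C A B" and g: "g \<in> hom C A D" and fg: "f \<bottom> g" and k: "k \<in> hom C Z A"
  shows comp_perp: "(k \<cdot> f) \<bottom> (k \<cdot> g)"
    and comp_row: "row C (k \<cdot> f) (k \<cdot> g) = k \<cdot> row C f g"
proof -
  note row = row_components[OF f g fg]
  have h: "k \<cdot> row C f g \<in> hom C Z (\<Oplus> [B, D])"
    and hl: "k \<cdot> row C f g \<cdot> prl B D = k \<cdot> f" and hr: "k \<cdot> row C f g \<cdot> prr B D = k \<cdot> g"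
    using f g k row by simp_all
  show "(k \<cdot> f) \<bottom> (k \<cdot> g)" "row C (k \<cdot> f) (k \<cdot> g) = k \<cdot> row C f g"
    using perpI[OF h _ _ hl hr] row_eqI[OF h _ _ hl hr] f g by simp_all
qed

lemma
  assumes f: "f \<in> hom C A B" and g: "g \<in> hom C A D" and fg: "f \<bottom> g"
    and h: "h \<in> hom C B B'" and k: "k \<in> hom C D D'"
  shows perp_comp: "(f \<cdot> h) \<bottom> (g \<cdot> k)"
    and row_comp_map_sum: "row C f g \<cdot> map_sum C [h, k] = row C (f \<cdot> h) (g \<cdot> k)"
proof -
  note row = row_components[OF f g fg]
  let ?m = "row C f g \<cdot> map_sum C [h, k]"
  have m: "?m \<in> hom C A (\<Oplus> [B', D'])"
    and ml: "?m \<cdot> prl B' D' = f \<cdot> h" and mr: "?m \<cdot> prr B' D' = g \<cdot> k"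
    using f g h k row by (simp_all add: comp_reassoc[OF row(2)] comp_reassoc[OF row(3)])
  show "(f \<cdot> h) \<bottom> (g \<cdot> k)" "?m = row C (f \<cdot> h) (g \<cdot> k)"
    using perpI[OF m _ _ ml mr] row_eqI[OF m _ _ ml mr] h k by simp_all
qed

lemma perp_cong_rst:
  assumes "f \<in> hom C A B" "g \<in> hom C A D" "f \<bottom> g" "f' \<in> hom C A B'" "\<rho> f' = \<rho> f"
  shows "f' \<bottom> g"
  using assms by (auto simp: dperp_def separates_def)

lemma join_eq_row_codiag: "f \<in> hom C A B \<Longrightarrow> f \<squnion> g = row C f g \<cdot> codiag C 2 B"
  by (simp add: join_def row_def)

lemma row_comp_cotuple:
  assumes f: "f \<in> hom C A B" and g: "g \<in> hom C A D" and fg: "f \<bottom> g"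
    and h: "h \<in> hom C B E" and k: "k \<in> hom C D E"
  shows "row C f g \<cdot> cotuple C E [h, k] = f \<cdot> h \<squnion> g \<cdot> k"
proof -
  have "row C f g \<cdot> cotuple C E [h, k] = row C f g \<cdot> map_sum C [h, k] \<cdot> codiag C 2 E"
    using row_hom[OF f g fg] h k by (simp add: map_sum_codiag[OF h k])
  then show ?thesis
    using join_eq_row_codiag[OF comp_hom[OF f h]] by (simp add: row_comp_map_sum[OF f g fg h k])
qed

lemma
  assumes f: "f \<in> hom C A B" and g: "g \<in> hom C A D" and fg: "f \<bottom> g"
  shows perp_sym: "g \<bottom> f"
    and row_swap: "row C g f = row C f g \<cdot> cotuple C (\<Oplus> [D, B]) [inr D B, inl D B]"
proof -
  note row = row_components[OF f g fg]
  let ?swap = "cotuple C (\<Oplus> [D, B]) [inr D B, inl D B]"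
  have B: "B \<in> Ob C" and D: "D \<in> Ob C" using f g by simp_all
  have swapl: "?swap \<cdot> prl D B = prr B D" and swapr: "?swap \<cdot> prr D B = prl B D"
    by (rule coprod_ext_binary[of B D]; use B D in simp)+
  have h: "row C f g \<cdot> ?swap \<in> hom C A (\<Oplus> [D, B])"
    and hl: "row C f g \<cdot> ?swap \<cdot> prl D B = g" and hr: "row C f g \<cdot> ?swap \<cdot> prr D B = f"
    using B D row by (simp_all add: swapl swapr)
  show "g \<bottom> f" "row C g f = row C f g \<cdot> ?swap"
    using perpI[OF h D B hl hr] row_eqI[OF h D B hl hr] by simp_all
qed

lemma join_commute:
  assumes f: "f \<in> hom C A B" and g: "g \<in> hom C A B" and fg: "f \<bottom> g"
  shows "f \<squnion> g = g \<squnion> f"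
proof -
  have B: "B \<in> Ob C" using f by simp
  have "cotuple C (\<Oplus> [B, B]) [inr B B, inl B B] \<cdot> codiag C 2 B = codiag C 2 B"
    by (rule coprod_ext_binary[of B B]) (use B in \<open>simp_all add: codiag_two\<close>)
  then show ?thesis
    using row_hom[OF f g fg] B
    by (simp add: join_eq_row_codiag[OF f] join_eq_row_codiag[OF g] row_swap[OF f g fg])
qed

definition unassoc_map :: "'a \<Rightarrow> 'a \<Rightarrow> 'a \<Rightarrow> 'b" where
  "unassoc_map A B D =
    cotuple C (\<Oplus> [A, \<Oplus> [B, D]]) [map_sum C [\<one> A, inl B D], inr B D \<cdot> inr A (\<Oplus> [B, D])]"

lemma
  assumes "A \<in> Ob C" "B \<in> Ob C" "D \<in> Ob C"
  shows assoc_map_hom: "assoc_map C A B D \<in> hom C (\<Oplus> [A, \<Oplus> [B, D]]) (\<Oplus> [\<Oplus> [A, B], D])"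
    and unassoc_map_hom: "unassoc_map A B D \<in> hom C (\<Oplus> [\<Oplus> [A, B], D]) (\<Oplus> [A, \<Oplus> [B, D]])"
  using assms by (simp_all add: assoc_map_def unassoc_map_def Let_def)

lemma
  assumes obs: "A \<in> Ob C" "B \<in> Ob C" "D \<in> Ob C"
  shows unassoc_assoc_map: "unassoc_map A B D \<cdot> assoc_map C A B D = \<one> (\<Oplus> [\<Oplus> [A, B], D])"
    and unassoc_map_prl: "unassoc_map A B D \<cdot> prl A (\<Oplus> [B, D]) = prl (\<Oplus> [A, B]) D \<cdot> prl A B"
    and unassoc_map_prr: "unassoc_map A B D \<cdot> prr A (\<Oplus> [B, D]) = map_sum C [prr A B, \<one> D]"
proof -
  show "unassoc_map A B D \<cdot> assoc_map C A B D = \<one> (\<Oplus> [\<Oplus> [A, B], D])"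
    by (rule coprod_ext_nested[of A B D _ "\<Oplus> [\<Oplus> [A, B], D]"])
      (use obs in \<open>simp_all add: assoc_map_def unassoc_map_def Let_def\<close>)
  show "unassoc_map A B D \<cdot> prl A (\<Oplus> [B, D]) = prl (\<Oplus> [A, B]) D \<cdot> prl A B"
    by (rule coprod_ext_nested[of A B D _ A]) (use obs in \<open>simp_all add: unassoc_map_def\<close>)
  show "unassoc_map A B D \<cdot> prr A (\<Oplus> [B, D]) = map_sum C [prr A B, \<one> D]"
    by (rule coprod_ext_nested[of A B D _ "\<Oplus> [B, D]"])
      (use obs in \<open>simp_all add: unassoc_map_def\<close>)
qed

lemma
  assumes f: "f \<in> hom C A B" and f': "f' \<in> hom C A D" and g: "g \<in> hom C A E"
    and ff': "f \<bottom> f'" and ff'g: "row C f f' \<bottom> g"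
  shows perp_row_left: "f \<bottom> g" and perp_row_right: "f' \<bottom> g" and perp_row_assoc: "f \<bottom> row C f' g"
    and row_assoc: "row C (row C f f') g = row C f (row C f' g) \<cdot> assoc_map C B D E"
proof -
  let ?BD = "\<Oplus> [B, D]" and ?DE = "\<Oplus> [D, E]" and ?nested = "row C (row C f f') g"
  have B: "B \<in> Ob C" and D: "D \<in> Ob C" and E: "E \<in> Ob C" and DE: "?DE \<in> Ob C"
    using f f' g by simp_all
  note row = row_components[OF f f' ff']
  note nested_row = row_components[OF row(1) g ff'g]
  have projs: "prl B D \<in> hom C ?BD B" "prr B D \<in> hom C ?BD D" and id: "\<one> E \<in> hom C E E"
    using B D E by simp_all
  show "f \<bottom> g" using perp_comp[OF row(1) g ff'g projs(1) id] row g by simp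
  show "f' \<bottom> g" using perp_comp[OF row(1) g ff'g projs(2) id] row g by simp
  have f'g_row: "row C f' g = ?nested \<cdot> map_sum C [prr B D, \<one> E]"
    using row_comp_map_sum[OF row(1) g ff'g projs(2) id] row g by simp
  let ?h = "?nested \<cdot> unassoc_map B D E"
  note assoc = assoc_map_hom[OF B D E] and unassoc = unassoc_map_hom[OF B D E]
  have h: "?h \<in> hom C A (\<Oplus> [B, ?DE])" by (rule comp_hom[OF nested_row(1) unassoc])
  have hl: "?h \<cdot> prl B ?DE = f"
    using B D E nested_row row unassoc by (simp add: unassoc_map_prl comp_reassoc[OF nested_row(2)])
  have hr: "?h \<cdot> prr B ?DE = row C f' g"
    using B D E nested_row unassoc by (simp add: unassoc_map_prr f'g_row)
  show "f \<bottom> row C f' g" by (rule perpI[OF h B DE hl hr])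
  have "row C f (row C f' g) = ?h" by (rule row_eqI[OF h B DE hl hr])
  then show "?nested = row C f (row C f' g) \<cdot> assoc_map C B D E"
    using B D E nested_row assoc unassoc by (simp add: unassoc_assoc_map)
qed

lemma
  assumes f: "f \<in> hom C A B" and f': "f' \<in> hom C A B" and g: "g \<in> hom C A D"
    and ff': "f \<bottom> f'" and join_g: "(f \<squnion> f') \<bottom> g"
  shows perp_row_if_join_perp: "row C f f' \<bottom> g"
    and row_join: "row C (f \<squnion> f') g = row C (row C f f') g \<cdot> map_sum C [codiag C 2 B, \<one> D]"
proof -
  have row: "row C f f' \<in> hom C A (\<Oplus> [B, B])" by (rule row_hom[OF f f' ff'])
  have codiag: "codiag C 2 B \<in> hom C (\<Oplus> [B, B]) B" and id: "\<one> D \<in> hom C D D"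
    and total: "\<rho> (codiag C 2 B) = \<one> (\<Oplus> [B, B])"
    using rst_codiag[of B 2] f g by simp_all
  have join: "f \<squnion> f' \<in> hom C A B"
    unfolding join_eq_row_codiag[OF f] by (rule comp_hom[OF row codiag])
  have "\<rho> (row C f f') = \<rho> (f \<squnion> f')"
    unfolding join_eq_row_codiag[OF f] by (rule rst_comp_total[OF row codiag total, symmetric])
  then show row_g: "row C f f' \<bottom> g" by (rule perp_cong_rst[OF join g join_g row])
  show "row C (f \<squnion> f') g = row C (row C f f') g \<cdot> map_sum C [codiag C 2 B, \<one> D]"
    using row_comp_map_sum[OF row g row_g codiag id] g by (simp add: join_eq_row_codiag[OF f])
qed

end

section \<open>The wand of an iteration operator\<close>

context traced_extensive_restriction_category
begin

lemma iter_wand_eq: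
  "f \<in> hom C X X \<Longrightarrow> g \<in> hom C X A \<Longrightarrow> iter_wand C Iter f g = Iter X A (row C f g)"
  by (simp add: iter_wand_def)

lemma iter_eq_trace:
  assumes A: "A \<in> Ob C" and h: "h \<in> hom C X (\<Oplus> [X, A])"
  shows "Iter X A h = induced_trace C Iter X X A (codiag C 2 X \<cdot> h)"
  using iter_unfold[OF A h] iter_hom[OF A h] A h by (simp add: induced_trace_def codiag_two)

lemma iter_wand_hom:
  assumes f: "f \<in> hom C X X" and g: "g \<in> hom C X A" and fg: "f \<bottom> g"
  shows "iter_wand C Iter f g \<in> hom C X A"
  unfolding iter_wand_eq[OF f g]
  by (rule iter_hom[OF _ row_hom[OF f g fg]]) (use g in simp)

lemma iter_wand_unfold:
  assumes f: "f \<in> hom C X X" and g: "g \<in> hom C X A" and fg: "f \<bottom> g"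
  shows "g \<bottom> (f \<cdot> iter_wand C Iter f g)"
    and "g \<squnion> (f \<cdot> iter_wand C Iter f g) = iter_wand C Iter f g"
proof -
  let ?w = "iter_wand C Iter f g"
  have A: "A \<in> Ob C" using g by simp
  have id: "\<one> A \<in> hom C A A" by (rule id_hom[OF A])
  have w: "?w \<in> hom C X A" by (rule iter_wand_hom[OF f g fg])
  have fw: "f \<cdot> ?w \<in> hom C X A" by (rule comp_hom[OF f w])
  have fw_g: "f \<cdot> ?w \<bottom> g" using perp_comp[OF f g fg w id] g by simp
  show "g \<bottom> (f \<cdot> ?w)" by (rule perp_sym[OF fw g fw_g])
  have "?w = row C f g \<cdot> cotuple C A [?w, \<one> A]"
    using iter_unfold[OF A row_hom[OF f g fg]] by (simp add: iter_wand_eq[OF f g])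
  also have "\<dots> = f \<cdot> ?w \<squnion> g" using row_comp_cotuple[OF f g fg w id] g by simp
  also have "\<dots> = g \<squnion> f \<cdot> ?w" by (rule join_commute[OF fw g fw_g])
  finally show "g \<squnion> (f \<cdot> ?w) = ?w" by simp
qed

lemma iter_wand_natural:
  assumes f: "f \<in> hom C X X" and g: "g \<in> hom C X A" and h: "h \<in> hom C A B" and fg: "f \<bottom> g"
  shows "f \<bottom> (g \<cdot> h)" and "iter_wand C Iter f g \<cdot> h = iter_wand C Iter f (g \<cdot> h)"
proof -
  have id: "\<one> X \<in> hom C X X" using f by simp
  show "f \<bottom> (g \<cdot> h)" using perp_comp[OF f g fg id h] f by simp
  have "iter_wand C Iter f g \<cdot> h = Iter X B (row C f g \<cdot> map_sum C [\<one> X, h])"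
    using iter_natural[OF row_hom[OF f g fg] h] by (simp add: iter_wand_eq[OF f g])
  also have "\<dots> = iter_wand C Iter f (g \<cdot> h)"
    using row_comp_map_sum[OF f g fg id h] f by (simp add: iter_wand_eq[OF f comp_hom[OF g h]])
  finally show "iter_wand C Iter f g \<cdot> h = iter_wand C Iter f (g \<cdot> h)" .
qed

lemma iter_wand_dinatural:
  assumes f: "f \<in> hom C X Y" and g: "g \<in> hom C X A" and k: "k \<in> hom C Y X" and fg: "f \<bottom> g"
  shows "(k \<cdot> f) \<bottom> (k \<cdot> g)" and "(f \<cdot> k) \<bottom> g"
    and "iter_wand C Iter (k \<cdot> f) (k \<cdot> g) = k \<cdot> iter_wand C Iter (f \<cdot> k) g"
proof -
  have A: "A \<in> Ob C" using g by simp
  have id: "\<one> A \<in> hom C A A" by (rule id_hom[OF A])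
  show "(k \<cdot> f) \<bottom> (k \<cdot> g)" by (rule comp_perp[OF f g fg k])
  show "(f \<cdot> k) \<bottom> g" using perp_comp[OF f g fg k id] g by simp
  have "iter_wand C Iter (k \<cdot> f) (k \<cdot> g) = Iter Y A (k \<cdot> row C f g)"
    by (simp only: iter_wand_eq[OF comp_hom[OF k f] comp_hom[OF k g]] comp_row[OF f g fg k])
  also have "\<dots> = k \<cdot> Iter X A (row C f g \<cdot> map_sum C [k, \<one> A])"
    by (rule iter_dinatural[OF A row_hom[OF f g fg] k])
  also have "\<dots> = k \<cdot> iter_wand C Iter (f \<cdot> k) g"
    using row_comp_map_sum[OF f g fg k id] g by (simp add: iter_wand_eq[OF comp_hom[OF f k] g])
  finally show "iter_wand C Iter (k \<cdot> f) (k \<cdot> g) = k \<cdot> iter_wand C Iter (f \<cdot> k) g" .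
qed

lemma
  assumes f: "f \<in> hom C X X" and g: "g \<in> hom C X A" and h: "h \<in> hom C X B"
    and gh: "g \<bottom> h" and fgh: "f \<bottom> row C g h"
  shows iter_wand_perp: "iter_wand C Iter f g \<bottom> iter_wand C Iter f h"
    and iter_wand_row:
      "iter_wand C Iter f (row C g h) = row C (iter_wand C Iter f g) (iter_wand C Iter f h)"
proof -
  note row = row_components[OF g h gh]
  let ?w = "iter_wand C Iter f (row C g h)"
  have A: "A \<in> Ob C" and B: "B \<in> Ob C" using g h by simp_all
  have projs: "prl A B \<in> hom C (\<Oplus> [A, B]) A" "prr A B \<in> hom C (\<Oplus> [A, B]) B"
    using A B by simp_all
  have w: "?w \<in> hom C X (\<Oplus> [A, B])" by (rule iter_wand_hom[OF f row(1) fgh])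
  have wl: "?w \<cdot> prl A B = iter_wand C Iter f g" and wr: "?w \<cdot> prr A B = iter_wand C Iter f h"
    by (simp_all only: iter_wand_natural(2)[OF f row(1) projs(1) fgh]
        iter_wand_natural(2)[OF f row(1) projs(2) fgh] row)
  show "iter_wand C Iter f g \<bottom> iter_wand C Iter f h" by (rule perpI[OF w A B wl wr])
  show "?w = row C (iter_wand C Iter f g) (iter_wand C Iter f h)"
    by (rule row_eqI[OF w A B wl wr, symmetric])
qed

lemma iter_wand_diagonal:
  assumes f: "f \<in> hom C X X" and f': "f' \<in> hom C X X" and g: "g \<in> hom C X A"
    and ff': "f \<bottom> f'" and join_g: "(f \<squnion> f') \<bottom> g"
  shows "f \<bottom> g" and "iter_wand C Iter f f' \<bottom> iter_wand C Iter f g"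
    and "iter_wand C Iter (f \<squnion> f') g =
      iter_wand C Iter (iter_wand C Iter f f') (iter_wand C Iter f g)"
proof -
  let ?w = "iter_wand C Iter f g" and ?w' = "iter_wand C Iter f f'"
    and ?fold = "map_sum C [codiag C 2 X, \<one> A]"
  have X: "X \<in> Ob C" and A: "A \<in> Ob C" using f g by simp_all
  have ff'g: "row C f f' \<bottom> g" by (rule perp_row_if_join_perp[OF f f' g ff' join_g])
  show fg: "f \<bottom> g" by (rule perp_row_left[OF f f' g ff' ff'g])
  have f'g: "f' \<bottom> g" by (rule perp_row_right[OF f f' g ff' ff'g])
  have f_f'g: "f \<bottom> row C f' g" by (rule perp_row_assoc[OF f f' g ff' ff'g])
  show "?w' \<bottom> ?w" by (rule iter_wand_perp[OF f f' g f'g f_f'g])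
  have join: "f \<squnion> f' \<in> hom C X X"
    using row_hom[OF f f' ff'] X by (simp add: join_eq_row_codiag[OF f])
  note f'g_row = row_hom[OF f' g f'g]
  note row = row_hom[OF f f'g_row f_f'g]
  have "iter_wand C Iter (f \<squnion> f') g =
      Iter X A (row C f (row C f' g) \<cdot> assoc_map C X X A \<cdot> ?fold)"
    by (simp only: iter_wand_eq[OF join g] row_join[OF f f' g ff' join_g]
        row_assoc[OF f f' g ff' ff'g])
  also have "\<dots> = Iter X A (row C f (row C f' g) \<cdot> (assoc_map C X X A \<cdot> ?fold))"
    using row assoc_map_hom[OF X X A] X A by simp
  also have "\<dots> = Iter X A (Iter X (\<Oplus> [X, A]) (row C f (row C f' g)))"
    by (rule iter_diagonal[OF A row, symmetric])
  also have "\<dots> = Iter X A (row C ?w' ?w)"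
    by (simp only: iter_wand_row[OF f f' g f'g f_f'g] flip: iter_wand_eq[OF f f'g_row])
  also have "\<dots> = iter_wand C Iter ?w' ?w"
    by (rule iter_wand_eq[symmetric, OF iter_wand_hom[OF f f' ff'] iter_wand_hom[OF f g fg]])
  finally show "iter_wand C Iter (f \<squnion> f') g = iter_wand C Iter ?w' ?w" .
qed

lemma kleene_wand_iter_wand: "kleene_wand C (iter_wand C Iter)"
proof
  fix f g h k f' X Y A B
  show "iter_wand C Iter f g \<in> hom C X A" if "f \<in> hom C X X" "g \<in> hom C X A" "f \<bottom> g"
    by (rule iter_wand_hom[OF that])
  show "g \<bottom> (f \<cdot> iter_wand C Iter f g) \<and> g \<squnion> (f \<cdot> iter_wand C Iter f g) = iter_wand C Iter f g"
    if "f \<in> hom C X X" "g \<in> hom C X A" "f \<bottom> g"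
    using iter_wand_unfold[OF that] by blast
  show "f \<bottom> (g \<cdot> h) \<and> iter_wand C Iter f g \<cdot> h = iter_wand C Iter f (g \<cdot> h)"
    if "f \<in> hom C X X" "g \<in> hom C X A" "h \<in> hom C A B" "f \<bottom> g"
    using iter_wand_natural[OF that] by blast
  show "(k \<cdot> f) \<bottom> (k \<cdot> g) \<and> (f \<cdot> k) \<bottom> g \<and>
      iter_wand C Iter (k \<cdot> f) (k \<cdot> g) = k \<cdot> iter_wand C Iter (f \<cdot> k) g"
    if "f \<in> hom C X Y" "g \<in> hom C X A" "k \<in> hom C Y X" "f \<bottom> g"
    using iter_wand_dinatural[OF that] by blast
  show "f \<bottom> g \<and> iter_wand C Iter f f' \<bottom> iter_wand C Iter f g \<and>
      iter_wand C Iter (f \<squnion> f') g = iter_wand C Iter (iter_wand C Iter f f') (iter_wand C Iter f g)"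
    if "f \<in> hom C X X" "f' \<in> hom C X X" "g \<in> hom C X A" "f \<bottom> f'" "(f \<squnion> f') \<bottom> g"
    using iter_wand_diagonal[OF that] by blast
qed

lemma uniform_iter_wand:
  assumes "uniform_iteration C Iter"
  shows "uniform_wand C (iter_wand C Iter)"
  unfolding uniform_wand_def
proof (intro allI impI, elim conjE)
  fix X Y A f g f' g' h
  assume f: "f \<in> hom C X X" and g: "g \<in> hom C X A" and f': "f' \<in> hom C Y Y"
    and g': "g' \<in> hom C Y A" and h: "h \<in> hom C X Y" and fg: "f \<bottom> g" and f'g': "f' \<bottom> g'"
    and hg': "h \<cdot> g' = g" and hf': "h \<cdot> f' = f \<cdot> h"
  have A: "A \<in> Ob C" using g by simp
  have id: "\<one> A \<in> hom C A A" by (rule id_hom[OF A])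
  have "row C f g \<cdot> map_sum C [h, \<one> A] = row C (f \<cdot> h) g"
    using row_comp_map_sum[OF f g fg h id] g by simp
  also have "\<dots> = h \<cdot> row C f' g'"
    using comp_row[OF f' g' f'g' h] by (simp only: hf' hg')
  finally have "Iter X A (row C f g) = h \<cdot> Iter Y A (row C f' g')"
    using assms A h row_hom[OF f g fg] row_hom[OF f' g' f'g']
    unfolding uniform_iteration_def by blast
  then show "h \<cdot> iter_wand C Iter f' g' = iter_wand C Iter f g"
    by (simp only: iter_wand_eq[OF f g] iter_wand_eq[OF f' g'])
qed

end

theorem proposition9p10:
  fixes C :: "('o, 'm, 'x) ecat_scheme" (structure)
    and Iter :: "'o \<Rightarrow> 'o \<Rightarrow> 'm \<Rightarrow> 'm"
  assumes "traced_extensive_restriction_category C Iter"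
  shows "(\<forall>X A f g. f \<in> hom C X X \<and> g \<in> hom C X A \<and> f \<bottom> g \<longrightarrow>
            iter_wand C Iter f g = Iter X A (row C f g) \<and>
            Iter X A (row C f g) = induced_trace C Iter X X A (codiag C 2 X \<cdot> row C f g)) \<and>
         kleene_wand C (iter_wand C Iter) \<and>
         perp_itegory C (iter_wand C Iter) \<and>
         (uniform_iteration C Iter \<longrightarrow> uniform_wand C (iter_wand C Iter))"
proof (intro conjI allI impI; (elim conjE)?)
  interpret traced_extensive_restriction_category C Iter by fact
  show wand: "kleene_wand C (iter_wand C Iter)" by (rule kleene_wand_iter_wand)
  show "perp_itegory C (iter_wand C Iter)"
    by (intro perp_itegory.intro extensive_restriction_category_axioms wand)
  show "uniform_wand C (iter_wand C Iter)" if "uniform_iteration C Iter"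
    using that by (rule uniform_iter_wand)
  fix X A f g
  assume f: "f \<in> hom C X X" and g: "g \<in> hom C X A" and fg: "f \<bottom> g"
  show "iter_wand C Iter f g = Iter X A (row C f g)" by (rule iter_wand_eq[OF f g])
  have "A \<in> Ob C" using g by simp
  then show "Iter X A (row C f g) = induced_trace C Iter X X A (codiag C 2 X \<cdot> row C f g)"
    by (rule iter_eq_trace[OF _ row_hom[OF f g fg]])
qed

end
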